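(* Every strongly $\sqrt{J}$-clean ring is a $\sqrt{J}U$ ring.
   Context: Rings are associative with identity $1\neq 0$ (not necessarily commutative). $J(R)$ is the Jacobson radical of $R$, $U(R)$ its group of units, and $\sqrt{J(R)}=\{z\in R : z^n\in J(R)\text{ for some } n\ge 1\}$. A ring $R$ is strongly $\sqrt{J}$-clean if every $x\in R$ can be written as $x=e+z$ with $e$ an idempotent of $R$, $z\in\sqrt{J(R)}$ and $ez=ze$. A ring $R$ is a $\sqrt{J}U$ ring if $U(R)\subseteq 1+\sqrt{J(R)}$. *)

theory Defs
  imports "HOL-Algebra.Ideal"
begin

locale left_ideal = additive_subgroup I R + ring R for I and R (structure) +
  assumes l_closed: "\<lbrakk>a \<in> I; x \<in> carrier R\<rbrakk> \<Longrightarrow> x \<otimes> a \<in> I"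

locale maximal_left_ideal = left_ideal +
  assumes notcarr: "I \<noteq> carrier R"
    and maximal: "\<lbrakk>left_ideal K R; I \<subseteq> K\<rbrakk> \<Longrightarrow> K = I \<or> K = carrier R"

text \<open>The Jacobson radical of a not necessarily commutative ring is the intersection of
  its maximal left ideals. The library locale \<open>maximalideal\<close> is about two-sided ideals,
  whose intersection can be strictly larger.\<close>

definition jacobson_radical :: "('a, 'm) ring_scheme \<Rightarrow> 'a set" where
  "jacobson_radical R = {x \<in> carrier R. \<forall>M. maximal_left_ideal M R \<longrightarrow> x \<in> M}"

definition sqrt_jacobson :: "('a, 'm) ring_scheme \<Rightarrow> 'a set" where
  "sqrt_jacobson R =
    {z \<in> carrier R. \<exists>n::nat. n \<ge> 1 \<and> z [^]\<^bsub>R\<^esub> n \<in> jacobson_radical R}"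

definition strongly_sqrtJ_clean :: "('a, 'm) ring_scheme \<Rightarrow> bool" where
  "strongly_sqrtJ_clean R \<longleftrightarrow>
    (\<forall>x \<in> carrier R. \<exists>e \<in> carrier R. \<exists>z \<in> sqrt_jacobson R.
      e \<otimes>\<^bsub>R\<^esub> e = e \<and> x = e \<oplus>\<^bsub>R\<^esub> z \<and> e \<otimes>\<^bsub>R\<^esub> z = z \<otimes>\<^bsub>R\<^esub> e)"

definition sqrtJU :: "('a, 'm) ring_scheme \<Rightarrow> bool" where
  "sqrtJU R \<longleftrightarrow> Units R \<subseteq> \<one>\<^bsub>R\<^esub> <+\<^bsub>R\<^esub> sqrt_jacobson R"

end

theory Submission
  imports Defs "HOL-Algebra.Multiplicative_Group"
begin

text \<open>
  Write a unit as \<open>u = e + z\<close> with \<open>e\<close> idempotent, \<open>e z = z e\<close> and \<open>z\<^sup>n\<close> in the Jacobson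
  radical, and let \<open>f = 1 - e\<close> be the complementary idempotent. Since \<open>f\<close> annihilates \<open>e\<close>,
  multiplication by \<open>f\<close> cannot distinguish \<open>u\<close> from \<open>z\<close>, so \<open>u\<^sup>n f = z\<^sup>n f = f z\<^sup>n\<close> lies in
  the radical (\<open>powers_agree_on_idempotent\<close>). The radical is a left ideal
  (\<open>jacobson_radical_left_mult\<close>), and cancelling \<open>u\<^sup>n\<close> on the left puts \<open>f\<close> itself in it.
  But the radical contains no idempotent other than zero (\<open>idempotent_in_jacobson_radical\<close>),
  hence \<open>e = 1\<close> and \<open>u = 1 + z\<close>.
\<close>

context ring
begin

lemma jacobson_radical_left_mult:
  assumes "x \<in> carrier R" "a \<in> jacobson_radical R"
  shows "x \<otimes> a \<in> jacobson_radical R"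
proof -
  have "x \<otimes> a \<in> M" if "maximal_left_ideal M R" for M
    using that assms left_ideal.l_closed[of M R a x]
    by (simp add: jacobson_radical_def maximal_left_ideal_def)
  then show ?thesis
    using assms by (simp add: jacobson_radical_def)
qed

text \<open>Closure under negation comes for free, as multiplication by \<open>-1\<close>.\<close>

lemma left_idealI:
  assumes "I \<subseteq> carrier R" "\<zero> \<in> I"
    and "\<And>a b. a \<in> I \<Longrightarrow> b \<in> I \<Longrightarrow> a \<oplus> b \<in> I"
    and lmult: "\<And>a x. a \<in> I \<Longrightarrow> x \<in> carrier R \<Longrightarrow> x \<otimes> a \<in> I"
  shows "left_ideal I R"
proof -
  have "\<ominus> a \<in> I" if "a \<in> I" for a
    using lmult[OF that, of "\<ominus> \<one>"] that assms(1) by (auto simp: l_minus)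
  then have "additive_subgroup I R"
    using assms by (intro additive_subgroup.intro) (auto simp: subgroup_def a_inv_def)
  then show ?thesis
    using assms ring_axioms by (simp add: left_ideal_def left_ideal_axioms_def)
qed

lemma left_ideal_Union_chain:
  assumes "C \<noteq> {}" and ideals: "\<And>K. K \<in> C \<Longrightarrow> left_ideal K R"
    and chain: "\<And>K L. K \<in> C \<Longrightarrow> L \<in> C \<Longrightarrow> K \<subseteq> L \<or> L \<subseteq> K"
  shows "left_ideal (\<Union>C) R"
proof (rule left_idealI)
  have sub: "additive_subgroup K R" if "K \<in> C" for K
    using ideals[OF that] by (simp add: left_ideal_def)
  show "\<Union>C \<subseteq> carrier R"
    using sub additive_subgroup.a_subset by blast
  show "\<zero> \<in> \<Union>C"
    using \<open>C \<noteq> {}\<close> sub additive_subgroup.zero_closed by blast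
  show "a \<oplus> b \<in> \<Union>C" if ab: "a \<in> \<Union>C" "b \<in> \<Union>C" for a b
  proof -
    obtain K L where KL: "K \<in> C" "L \<in> C" "a \<in> K" "b \<in> L"
      using ab by blast
    then obtain M where "M \<in> C" "a \<in> M" "b \<in> M"
      using chain[of K L] by blast
    then show ?thesis
      using additive_subgroup.a_closed[OF sub] by blast
  qed
  show "x \<otimes> a \<in> \<Union>C" if "a \<in> \<Union>C" "x \<in> carrier R" for a x
  proof -
    obtain K where "K \<in> C" "a \<in> K"
      using \<open>a \<in> \<Union>C\<close> by blast
    then show ?thesis
      using left_ideal.l_closed[OF ideals _ \<open>x \<in> carrier R\<close>] by blast
  qed
qed

lemma left_ideal_eq_carrier:
  assumes "left_ideal I R" "\<one> \<in> I"
  shows "I = carrier R"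
proof
  show "I \<subseteq> carrier R"
    using assms(1) by (auto simp: left_ideal_def dest: additive_subgroup.a_subset)
  show "carrier R \<subseteq> I"
    using left_ideal.l_closed[OF assms] by auto
qed

text \<open>Properness means missing \<open>1\<close>, a condition that survives unions of chains; this is what
  makes Zorn's lemma applicable.\<close>

lemma proper_left_ideal_in_maximal:
  assumes I: "left_ideal I R" "\<one> \<notin> I"
  obtains M where "maximal_left_ideal M R" "I \<subseteq> M"
proof -
  define A where "A = {K. left_ideal K R \<and> I \<subseteq> K \<and> \<one> \<notin> K}"
  have "A \<noteq> {}"
    using I by (auto simp: A_def)
  moreover have "\<Union>C \<in> A" if "C \<noteq> {}" "subset.chain A C" for C
  proof -
    have C: "C \<subseteq> A" "\<And>K L. K \<in> C \<Longrightarrow> L \<in> C \<Longrightarrow> K \<subseteq> L \<or> L \<subseteq> K"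
      using \<open>subset.chain A C\<close> by (simp_all add: subset_chain_def)
    then have "left_ideal (\<Union>C) R"
      using \<open>C \<noteq> {}\<close> by (intro left_ideal_Union_chain) (auto simp: A_def)
    then show ?thesis
      using \<open>C \<noteq> {}\<close> C(1) by (auto simp: A_def)
  qed
  ultimately obtain M where M: "M \<in> A" and max: "\<And>K. K \<in> A \<Longrightarrow> M \<subseteq> K \<Longrightarrow> K = M"
    using subset_Zorn_nonempty[of A] by blast
  have "K = M \<or> K = carrier R" if "left_ideal K R" "M \<subseteq> K" for K
    using that M max left_ideal_eq_carrier unfolding A_def by blast
  then have "maximal_left_ideal M R"
    using M by (auto simp: A_def maximal_left_ideal_def maximal_left_ideal_axioms_def)
  then show thesis
    using M that by (auto simp: A_def)
qed

lemma left_ideal_principal: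
  assumes a: "a \<in> carrier R"
  shows "left_ideal ((\<lambda>r. r \<otimes> a) ` carrier R) R"
proof (rule left_idealI)
  show "(\<lambda>r. r \<otimes> a) ` carrier R \<subseteq> carrier R"
    using a by blast
  show "\<zero> \<in> (\<lambda>r. r \<otimes> a) ` carrier R"
    using a by (intro image_eqI[of _ _ \<zero>]) simp_all
next
  fix x y assume "x \<in> (\<lambda>r. r \<otimes> a) ` carrier R" "y \<in> (\<lambda>r. r \<otimes> a) ` carrier R"
  then obtain r s where "r \<in> carrier R" "s \<in> carrier R" "x = r \<otimes> a" "y = s \<otimes> a"
    by blast
  then show "x \<oplus> y \<in> (\<lambda>r. r \<otimes> a) ` carrier R"
    using a by (intro image_eqI[of _ _ "r \<oplus> s"]) (simp_all add: l_distr)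
next
  fix x y assume "x \<in> (\<lambda>r. r \<otimes> a) ` carrier R" and y: "y \<in> carrier R"
  then obtain r where "r \<in> carrier R" "x = r \<otimes> a"
    by blast
  then show "y \<otimes> x \<in> (\<lambda>r. r \<otimes> a) ` carrier R"
    using a y by (intro image_eqI[of _ _ "y \<otimes> r"]) (simp_all add: m_assoc)
qed

text \<open>If \<open>R a\<close> were proper, a maximal left ideal above it would contain both \<open>a\<close> and \<open>j\<close>,
  hence \<open>1\<close>.\<close>

lemma left_invertible_if_complement_in_jacobson_radical:
  assumes a: "a \<in> carrier R" and j: "j \<in> jacobson_radical R" and sum: "a \<oplus> j = \<one>"
  obtains r where "r \<in> carrier R" "r \<otimes> a = \<one>"
proof -
  let ?I = "(\<lambda>r. r \<otimes> a) ` carrier R"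
  have "\<one> \<in> ?I"
  proof (rule ccontr)
    assume "\<one> \<notin> ?I"
    then obtain M where M: "maximal_left_ideal M R" and "?I \<subseteq> M"
      using proper_left_ideal_in_maximal left_ideal_principal[OF a] by blast
    moreover have "a \<in> ?I"
      using a by (intro image_eqI[of _ _ \<one>]) simp_all
    moreover have "j \<in> M"
      using j M by (simp add: jacobson_radical_def)
    moreover have L: "left_ideal M R"
      using M by (simp add: maximal_left_ideal_def)
    ultimately have "\<one> \<in> M"
      using additive_subgroup.a_closed[of M R a j] sum by (auto simp: left_ideal_def)
    then show False
      using M left_ideal_eq_carrier[OF L]
      by (simp add: maximal_left_ideal_def maximal_left_ideal_axioms_def)
  qed
  then show thesis
    using that by (metis imageE)
qed

text \<open>Being the complement of an element of the radical, \<open>e\<close> has a left inverse \<open>r\<close>, and then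
  \<open>1 = r e = r e e = e\<close>.\<close>

lemma idempotent_in_jacobson_radical:
  assumes e: "e \<in> carrier R" "e \<otimes> e = e" and J: "\<one> \<ominus> e \<in> jacobson_radical R"
  shows "e = \<one>"
proof -
  have "e \<oplus> (\<one> \<ominus> e) = \<one>"
    using e a_lcomm[of e \<one> "\<ominus> e"] by (simp add: minus_eq r_neg)
  then obtain r where "r \<in> carrier R" "r \<otimes> e = \<one>"
    using left_invertible_if_complement_in_jacobson_radical e J by blast
  then show ?thesis
    using e m_assoc[of r e e] by simp
qed

text \<open>Each factor \<open>u\<close> next to \<open>f\<close> may be replaced by \<open>z\<close>, which then moves past \<open>f\<close> and
  leaves \<open>f\<close> adjacent to the next factor.\<close>

lemma powers_agree_on_idempotent:
  assumes "f \<in> carrier R" "u \<in> carrier R" "z \<in> carrier R"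
    and agree: "u \<otimes> f = z \<otimes> f" and comm: "f \<otimes> z = z \<otimes> f"
  shows "u [^] (n::nat) \<otimes> f = f \<otimes> z [^] n"
proof (induction n)
  case 0
  then show ?case
    using assms by simp
next
  case (Suc n)
  have "u [^] Suc n \<otimes> f = u [^] n \<otimes> (u \<otimes> f)"
    using assms by (simp add: m_assoc)
  also have "\<dots> = (u [^] n \<otimes> f) \<otimes> z"
    using assms by (simp add: m_assoc)
  also have "\<dots> = f \<otimes> z [^] Suc n"
    using assms Suc by (simp add: m_assoc)
  finally show ?case .
qed

end

theorem lemma3p2:
  fixes R (structure)
  assumes "ring R"
    and "\<one> \<noteq> \<zero>"
    and "strongly_sqrtJ_clean R"
  shows "sqrtJU R"
proof -
  interpret ring R by fact
  have "u \<in> \<one> <+\<^bsub>R\<^esub> sqrt_jacobson R" if u: "u \<in> Units R" for u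
  proof -
    have uR: "u \<in> carrier R"
      using u by (rule Units_closed)
    then obtain e z where e: "e \<in> carrier R" "e \<otimes> e = e" and z: "z \<in> sqrt_jacobson R"
      and ueq: "u = e \<oplus> z" and comm: "e \<otimes> z = z \<otimes> e"
      using assms(3) unfolding strongly_sqrtJ_clean_def by blast
    obtain n :: nat where zR: "z \<in> carrier R" and zn: "z [^] n \<in> jacobson_radical R"
      using z by (auto simp: sqrt_jacobson_def)
    define f where "f = \<one> \<ominus> e"
    have fR: "f \<in> carrier R"
      using e by (simp add: f_def)
    have "e \<otimes> f = \<zero>"
      using e by (simp add: f_def minus_eq r_distr r_minus r_neg)
    then have "u \<otimes> f = z \<otimes> f"
      using e zR fR by (simp add: ueq l_distr)
    moreover have "f \<otimes> z = z \<otimes> f"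
      using e zR comm by (simp add: f_def minus_eq l_distr r_distr l_minus r_minus)
    ultimately have "u [^] n \<otimes> f = f \<otimes> z [^] n"
      using powers_agree_on_idempotent fR uR zR by blast
    then have uf: "u [^] n \<otimes> f \<in> jacobson_radical R"
      using jacobson_radical_left_mult[OF fR zn] by simp
    have un: "u [^] n \<in> Units R"
      using u by (rule Units_pow_closed)
    then have "inv (u [^] n) \<otimes> (u [^] n \<otimes> f) = f"
      using fR by (simp add: m_assoc[symmetric] Units_closed)
    then have "f \<in> jacobson_radical R"
      using jacobson_radical_left_mult[OF _ uf, of "inv (u [^] n)"] un by simp
    then have "e = \<one>"
      using idempotent_in_jacobson_radical e by (simp add: f_def)
    then show ?thesis
      using z ueq by (auto simp: a_l_coset_def')
  qed
  then show ?thesis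
    by (auto simp: sqrtJU_def)
qed

end
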